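(* Let $G$ and $H$ be finite groups, let $\tau : kH\otimes kG \to kG\otimes kH$ be a non-trivial strongly graded twisting map and denote $\tau(h\otimes g) = \lambda_{h,g}\, g\otimes h$ with $\lambda_{h,g} \in k^{\times}$ for $g\in G$, $h\in H$. If $\lambda_{h,g}=\lambda_{s^{-1},g}\lambda_{sh,g}$ and $\lambda_{h,g}=\lambda_{h,r^{-1}}\lambda_{h,rg}$ for all $g,r\in G$ and $h,s\in H$, then $kG\otimes_{\tau} kH$ is a noncommutative symmetric Frobenius algebra.
   Context: $k$ is a field, $\otimes=\otimes_k$, and $1$ denotes identity maps. A Frobenius algebra over $k$ is a tuple $(A,\nabla,\eta,\Delta,\epsilon)$ with $(A,\nabla,\eta)$ an associative unital $k$-algebra, $(A,\Delta,\epsilon)$ a coassociative counital $k$-coalgebra, and $\Delta\nabla=(1\otimes\nabla)(\Delta\otimes 1)=(\nabla\otimes 1)(1\otimes\Delta)$. Its pairing is $\beta=\epsilon\nabla$; it is symmetric if $\beta(a\otimes b)=\beta(b\otimes a)$ for all $a,b$. For a finite group $G$, $kG$ is a Frobenius algebra with its usual algebra structure and, for $g\in G$, $\epsilon(g)=\delta_{g,1}$ and $\Delta(g)=\sum_{r\in G} gr\otimes r^{-1}$. A twisting map for algebras $A$, $B$ is a bijective $k$-linear map $\tau:B\otimes A\to A\otimes B$ such that $\tau(b\otimes 1_A)=1_A\otimes b$ and $\tau(1_B\otimes a)=a\otimes 1_B$ for all $a\in A$, $b\in B$, and $\tau(\nabla_B\otimes\nabla_A)=(\nabla_A\otimes\nabla_B)(1\otimes\tau\otimes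 1)(\tau\otimes\tau)(1\otimes\tau\otimes 1)$. The trivial twisting map is the flip $b\otimes a\mapsto a\otimes b$. With $kG=\bigoplus_{g\in G}kg$ and $kH=\bigoplus_{h\in H}kh$ graded by $G$ and $H$, $\tau$ is strongly graded if $\tau(kh\otimes kg)\subseteq kg\otimes kh$ for all $g\in G$, $h\in H$. The twisted tensor product $A\otimes_\tau B$ is the vector space $A\otimes B$ with $\nabla_{A\otimes_\tau B}=(\nabla_A\otimes\nabla_B)(1\otimes\tau\otimes 1)$, $\eta_{A\otimes_\tau B}=\eta_A\otimes\eta_B$, $\Delta_{A\otimes_\tau B}=(1\otimes\tau^{-1}\otimes 1)(\Delta_A\otimes\Delta_B)$, $\epsilon_{A\otimes_\tau B}=\epsilon_A\otimes\epsilon_B$; the Frobenius structure on $kG\otimes_\tau kH$ is this induced one. *)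

theory Defs
  imports Complex_Main "HOL-Library.Poly_Mapping"
begin

text \<open>
  Every vector space over the field \<open>'k\<close> is modelled as the space \<open>'x \<Rightarrow>\<^sub>0 'k\<close> of finitely supported
  coefficient functions with respect to a basis indexed by the type \<open>'x\<close>.  The tensor product of
  \<open>'x \<Rightarrow>\<^sub>0 'k\<close> and \<open>'y \<Rightarrow>\<^sub>0 'k\<close> is then \<open>'x \<times> 'y \<Rightarrow>\<^sub>0 'k\<close>.  The ground field itself is kept as \<open>'k\<close>,
  with \<open>k \<otimes> V\<close> and \<open>V \<otimes> k\<close> identified with \<open>V\<close>.
\<close>

definition scale :: "'k::field \<Rightarrow> ('x \<Rightarrow>\<^sub>0 'k) \<Rightarrow> ('x \<Rightarrow>\<^sub>0 'k)" where
  "scale c v = Poly_Mapping.map ((*) c) v"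

lemma lookup_scale [simp]: "Poly_Mapping.lookup (scale c v) x = c * Poly_Mapping.lookup v x"
  by (simp add: scale_def Poly_Mapping.map.rep_eq when_def)

interpretation kvec: vector_space scale
  by unfold_locales (auto intro!: poly_mapping_eqI simp: lookup_add algebra_simps)

abbreviation klinear :: "(('x \<Rightarrow>\<^sub>0 'k::field) \<Rightarrow> ('y \<Rightarrow>\<^sub>0 'k)) \<Rightarrow> bool" where
  "klinear \<equiv> Vector_Spaces.linear scale scale"

definition basis :: "'x \<Rightarrow> ('x \<Rightarrow>\<^sub>0 'k::field)" where
  "basis x = Poly_Mapping.single x 1"

definition lin_ext :: "('x \<Rightarrow> ('y \<Rightarrow>\<^sub>0 'k::field)) \<Rightarrow> ('x \<Rightarrow>\<^sub>0 'k) \<Rightarrow> ('y \<Rightarrow>\<^sub>0 'k)" where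
  "lin_ext f v = (\<Sum>x\<in>Poly_Mapping.keys v. scale (Poly_Mapping.lookup v x) (f x))"

definition relabel :: "('x \<Rightarrow> 'y) \<Rightarrow> ('x \<Rightarrow>\<^sub>0 'k::field) \<Rightarrow> ('y \<Rightarrow>\<^sub>0 'k)" where
  "relabel f = lin_ext (\<lambda>x. basis (f x))"


subsection \<open>Tensor products of vectors and of linear maps\<close>

definition tens :: "('x \<Rightarrow>\<^sub>0 'k::field) \<Rightarrow> ('y \<Rightarrow>\<^sub>0 'k) \<Rightarrow> ('x \<times> 'y \<Rightarrow>\<^sub>0 'k)"  (infixr "\<otimes>\<^sub>v" 72) where
  "a \<otimes>\<^sub>v b = (\<Sum>x\<in>Poly_Mapping.keys a. \<Sum>y\<in>Poly_Mapping.keys b. Poly_Mapping.single (x, y) (Poly_Mapping.lookup a x * Poly_Mapping.lookup b y))"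

definition tmap :: "(('x \<Rightarrow>\<^sub>0 'k::field) \<Rightarrow> ('x' \<Rightarrow>\<^sub>0 'k)) \<Rightarrow> (('y \<Rightarrow>\<^sub>0 'k) \<Rightarrow> ('y' \<Rightarrow>\<^sub>0 'k))
    \<Rightarrow> ('x \<times> 'y \<Rightarrow>\<^sub>0 'k) \<Rightarrow> ('x' \<times> 'y' \<Rightarrow>\<^sub>0 'k)"  (infixr "\<otimes>\<^sub>m" 72) where
  "f \<otimes>\<^sub>m g = lin_ext (\<lambda>(x, y). f (basis x) \<otimes>\<^sub>v g (basis y))"

definition assoc_r :: "(('x \<times> 'y) \<times> 'z \<Rightarrow>\<^sub>0 'k::field) \<Rightarrow> ('x \<times> 'y \<times> 'z \<Rightarrow>\<^sub>0 'k)" where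
  "assoc_r = relabel (\<lambda>((x, y), z). (x, y, z))"

definition assoc_l :: "('x \<times> 'y \<times> 'z \<Rightarrow>\<^sub>0 'k::field) \<Rightarrow> (('x \<times> 'y) \<times> 'z \<Rightarrow>\<^sub>0 'k)" where
  "assoc_l = relabel (\<lambda>(x, y, z). ((x, y), z))"

definition flip :: "('x \<times> 'y \<Rightarrow>\<^sub>0 'k::field) \<Rightarrow> ('y \<times> 'x \<Rightarrow>\<^sub>0 'k)" where
  "flip = relabel (\<lambda>(x, y). (y, x))"

text \<open>\<open>1 \<otimes> t \<otimes> 1\<close> on a fourfold tensor product bracketed in pairs.\<close>

definition mid :: "(('x \<times> 'y \<Rightarrow>\<^sub>0 'k::field) \<Rightarrow> ('x' \<times> 'y' \<Rightarrow>\<^sub>0 'k))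
    \<Rightarrow> (('w \<times> 'x) \<times> ('y \<times> 'z) \<Rightarrow>\<^sub>0 'k) \<Rightarrow> (('w \<times> 'x') \<times> ('y' \<times> 'z) \<Rightarrow>\<^sub>0 'k)" where
  "mid t = relabel (\<lambda>(w, (x, y), z). ((w, x), (y, z)))
         \<circ> (id \<otimes>\<^sub>m (t \<otimes>\<^sub>m id))
         \<circ> relabel (\<lambda>((w, x), (y, z)). (w, (x, y), z))"

text \<open>\<open>f \<otimes> 1\<close> and \<open>1 \<otimes> f\<close> for a functional \<open>f\<close>, with values in \<open>k \<otimes> V = V\<close> and \<open>V \<otimes> k = V\<close>, and
  \<open>f \<otimes> g\<close> for two functionals, with values in \<open>k \<otimes> k = k\<close>.\<close>

definition contract_l :: "(('x \<Rightarrow>\<^sub>0 'k::field) \<Rightarrow> 'k) \<Rightarrow> ('x \<times> 'y \<Rightarrow>\<^sub>0 'k) \<Rightarrow> ('y \<Rightarrow>\<^sub>0 'k)" where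
  "contract_l f = lin_ext (\<lambda>(x, y). scale (f (basis x)) (basis y))"

definition contract_r :: "(('y \<Rightarrow>\<^sub>0 'k::field) \<Rightarrow> 'k) \<Rightarrow> ('x \<times> 'y \<Rightarrow>\<^sub>0 'k) \<Rightarrow> ('x \<Rightarrow>\<^sub>0 'k)" where
  "contract_r f = lin_ext (\<lambda>(x, y). scale (f (basis y)) (basis x))"

definition tfunctional :: "(('x \<Rightarrow>\<^sub>0 'k::field) \<Rightarrow> 'k) \<Rightarrow> (('y \<Rightarrow>\<^sub>0 'k) \<Rightarrow> 'k) \<Rightarrow> ('x \<times> 'y \<Rightarrow>\<^sub>0 'k) \<Rightarrow> 'k" where
  "tfunctional f g v = (\<Sum>(x, y)\<in>Poly_Mapping.keys v. Poly_Mapping.lookup v (x, y) * (f (basis x) * g (basis y)))"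


subsection \<open>Frobenius algebras\<close>

record (overloaded) ('x, 'k::field) frob =
  nabla :: "('x \<times> 'x \<Rightarrow>\<^sub>0 'k) \<Rightarrow> ('x \<Rightarrow>\<^sub>0 'k)"
  eta :: "'k \<Rightarrow> ('x \<Rightarrow>\<^sub>0 'k)"
  Delta :: "('x \<Rightarrow>\<^sub>0 'k) \<Rightarrow> ('x \<times> 'x \<Rightarrow>\<^sub>0 'k)"
  eps :: "('x \<Rightarrow>\<^sub>0 'k) \<Rightarrow> 'k"

abbreviation one_of :: "('x, 'k::field) frob \<Rightarrow> ('x \<Rightarrow>\<^sub>0 'k)" where
  "one_of A \<equiv> eta A 1"

definition unital_algebra :: "('x, 'k::field) frob \<Rightarrow> bool" where
  "unital_algebra A \<longleftrightarrow>
     klinear (nabla A) \<and> Vector_Spaces.linear (*) scale (eta A) \<and>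
     nabla A \<circ> (nabla A \<otimes>\<^sub>m id) = nabla A \<circ> (id \<otimes>\<^sub>m nabla A) \<circ> assoc_r \<and>
     (\<forall>c a. nabla A (eta A c \<otimes>\<^sub>v a) = scale c a) \<and>
     (\<forall>c a. nabla A (a \<otimes>\<^sub>v eta A c) = scale c a)"

definition counital_coalgebra :: "('x, 'k::field) frob \<Rightarrow> bool" where
  "counital_coalgebra A \<longleftrightarrow>
     klinear (Delta A) \<and> Vector_Spaces.linear scale (*) (eps A) \<and>
     assoc_r \<circ> (Delta A \<otimes>\<^sub>m id) \<circ> Delta A = (id \<otimes>\<^sub>m Delta A) \<circ> Delta A \<and>
     contract_l (eps A) \<circ> Delta A = id \<and>
     contract_r (eps A) \<circ> Delta A = id"

definition frobenius_algebra :: "('x, 'k::field) frob \<Rightarrow> bool" where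
  "frobenius_algebra A \<longleftrightarrow>
     unital_algebra A \<and> counital_coalgebra A \<and>
     Delta A \<circ> nabla A = (id \<otimes>\<^sub>m nabla A) \<circ> assoc_r \<circ> (Delta A \<otimes>\<^sub>m id) \<and>
     Delta A \<circ> nabla A = (nabla A \<otimes>\<^sub>m id) \<circ> assoc_l \<circ> (id \<otimes>\<^sub>m Delta A)"

definition pairing :: "('x, 'k::field) frob \<Rightarrow> ('x \<times> 'x \<Rightarrow>\<^sub>0 'k) \<Rightarrow> 'k" where
  "pairing A = eps A \<circ> nabla A"

definition symmetric :: "('x, 'k::field) frob \<Rightarrow> bool" where
  "symmetric A \<longleftrightarrow> (\<forall>a b. pairing A (a \<otimes>\<^sub>v b) = pairing A (b \<otimes>\<^sub>v a))"

definition commutative :: "('x, 'k::field) frob \<Rightarrow> bool" where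
  "commutative A \<longleftrightarrow> (\<forall>a b. nabla A (a \<otimes>\<^sub>v b) = nabla A (b \<otimes>\<^sub>v a))"

text \<open>Groups are the (not necessarily commutative) additively written groups of class \<open>group_add\<close>;
  \<open>g + h\<close>, \<open>0\<close>, \<open>- g\<close> stand for \<open>gh\<close>, \<open>1\<close> and the inverse of \<open>g\<close>.\<close>

definition group_algebra :: "('g::{finite,group_add}, 'k::field) frob" where
  "group_algebra = \<lparr>
     nabla = lin_ext (\<lambda>(g, h). basis (g + h)),
     eta = (\<lambda>c. scale c (basis 0)),
     Delta = lin_ext (\<lambda>g. \<Sum>r\<in>UNIV. basis (g + r) \<otimes>\<^sub>v basis (- r)),
     eps = (\<lambda>v. Poly_Mapping.lookup v 0) \<rparr>"


subsection \<open>Twisted tensor products\<close>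

definition twisting_map :: "('a, 'k::field) frob \<Rightarrow> ('b, 'k) frob
    \<Rightarrow> (('b \<times> 'a \<Rightarrow>\<^sub>0 'k) \<Rightarrow> ('a \<times> 'b \<Rightarrow>\<^sub>0 'k)) \<Rightarrow> bool" where
  "twisting_map A B t \<longleftrightarrow>
     klinear t \<and> bij t \<and>
     (\<forall>b. t (b \<otimes>\<^sub>v one_of A) = one_of A \<otimes>\<^sub>v b) \<and>
     (\<forall>a. t (one_of B \<otimes>\<^sub>v a) = a \<otimes>\<^sub>v one_of B) \<and>
     t \<circ> (nabla B \<otimes>\<^sub>m nabla A) = (nabla A \<otimes>\<^sub>m nabla B) \<circ> mid t \<circ> (t \<otimes>\<^sub>m t) \<circ> mid t"

definition strongly_graded :: "(('h \<times> 'g \<Rightarrow>\<^sub>0 'k::field) \<Rightarrow> ('g \<times> 'h \<Rightarrow>\<^sub>0 'k)) \<Rightarrow> bool" where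
  "strongly_graded t \<longleftrightarrow>
     (\<forall>g h. t ` kvec.span {basis h \<otimes>\<^sub>v basis g} \<subseteq> kvec.span {basis g \<otimes>\<^sub>v basis h})"

definition twisted_tensor :: "('a, 'k::field) frob \<Rightarrow> (('b \<times> 'a \<Rightarrow>\<^sub>0 'k) \<Rightarrow> ('a \<times> 'b \<Rightarrow>\<^sub>0 'k))
    \<Rightarrow> ('b, 'k) frob \<Rightarrow> ('a \<times> 'b, 'k) frob" where
  "twisted_tensor A t B = \<lparr>
     nabla = (nabla A \<otimes>\<^sub>m nabla B) \<circ> mid t,
     eta = (\<lambda>c. scale c (one_of A \<otimes>\<^sub>v one_of B)),
     Delta = mid (inv t) \<circ> (Delta A \<otimes>\<^sub>m Delta B),
     eps = tfunctional (eps A) (eps B) \<rparr>"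

end

theory Submission
  imports Defs "HOL-Library.Product_Plus"
begin

text \<open>
  The two hypotheses on \<open>lam\<close> say that it is a bicharacter, so \<open>c (g, h) (g', h') = lam h g'\<close> is a
  normalised 2-cocycle on the product group and the twisted tensor product is the corresponding
  twisted group algebra, with \<open>\<Delta> x = \<Sum>\<^bsub>u + v = x\<^esub> (c u v)\<^sup>-\<^sup>1 u \<otimes> v\<close>.  Such an algebra is Frobenius by
  the cocycle identity, and symmetric because the cocycle identity at \<open>x, - x, x\<close> gives
  \<open>c x (- x) = c (- x) x\<close>.  It is noncommutative as soon as some \<open>lam h g\<close> differs from 1.
\<close>

section \<open>Linear maps on based vector spaces\<close>

lemma lookup_basis: "Poly_Mapping.lookup (basis x) y = (if x = y then 1 else 0)"
  by (simp add: basis_def lookup_single when_def)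

lemma klinear_iff:
  "klinear f \<longleftrightarrow> (\<forall>a b. f (a + b) = f a + f b) \<and> (\<forall>c a. f (scale c a) = scale c (f a))"
  by (simp add: Vector_Spaces.linear_iff kvec.vector_space_axioms)

lemma klinear_comp [simp]: "klinear f \<Longrightarrow> klinear g \<Longrightarrow> klinear (g \<circ> f)"
  by (simp add: klinear_iff)

lemma klinear_id [simp]: "klinear id"
  by (simp add: klinear_iff)

lemma klinear_scale: "klinear f \<Longrightarrow> f (scale c a) = scale c (f a)"
  by (simp add: klinear_iff)

lemma klinear_sum: "klinear f \<Longrightarrow> f (sum g A) = (\<Sum>x\<in>A. f (g x))"
  unfolding module_hom_iff_linear[symmetric] by (rule module_hom.sum)

lemma vec_eq_sum_basis:
  "v = (\<Sum>x\<in>Poly_Mapping.keys v. scale (Poly_Mapping.lookup v x) (basis x))"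
  by (rule poly_mapping_eqI)
    (simp add: lookup_sum lookup_basis if_distrib in_keys_iff cong: if_cong)

lemma klinear_eqI:
  assumes "klinear f" "klinear g" "\<And>x. f (basis x) = g (basis x)"
  shows "f = g"
proof
  fix v
  show "f v = g v"
    by (subst (1 2) vec_eq_sum_basis[of v]) (simp only: assms(1,2)[THEN klinear_sum] assms(1,2)[THEN klinear_scale] assms(3))
qed

lemma vec_induct [case_names basis zero add scale]:
  assumes "\<And>x. P (basis x)" "P 0" "\<And>a b. P a \<Longrightarrow> P b \<Longrightarrow> P (a + b)" "\<And>c a. P a \<Longrightarrow> P (scale c a)"
  shows "P v"
proof -
  have "P (\<Sum>x\<in>S. scale (Poly_Mapping.lookup v x) (basis x))" if "finite S" for S
    using that by induction (auto intro: assms)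
  then show ?thesis
    by (subst vec_eq_sum_basis) simp
qed

text \<open>\<open>lin_ext\<close> sums over the keys of its argument, and these can disappear under
  addition and scaling. A common finite index set lets linearity be checked term by term.\<close>

lemma lin_ext_superset:
  assumes "finite S" "Poly_Mapping.keys v \<subseteq> S"
  shows "lin_ext f v = (\<Sum>x\<in>S. scale (Poly_Mapping.lookup v x) (f x))"
  unfolding lin_ext_def by (rule sum.mono_neutral_left) (use assms in \<open>auto simp: in_keys_iff\<close>)

lemma klinear_lin_ext [simp]:
  fixes f :: "'a \<Rightarrow> ('b \<Rightarrow>\<^sub>0 'k::field)"
  shows "klinear (lin_ext f)"
  unfolding klinear_iff
proof (intro conjI allI)
  fix a b :: "'a \<Rightarrow>\<^sub>0 'k" and c :: 'k
  let ?S = "Poly_Mapping.keys a \<union> Poly_Mapping.keys b"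
  have "Poly_Mapping.keys (a + b) \<subseteq> ?S"
    by (rule Poly_Mapping.keys_add)
  then show "lin_ext f (a + b) = lin_ext f a + lin_ext f b"
    by (simp add: lin_ext_superset[of ?S] lookup_add kvec.scale_left_distrib sum.distrib)
  have "Poly_Mapping.keys (scale c a) \<subseteq> Poly_Mapping.keys a"
    by (auto simp: in_keys_iff)
  then show "lin_ext f (scale c a) = scale c (lin_ext f a)"
    by (simp add: lin_ext_superset[of "Poly_Mapping.keys a"] kvec.scale_sum_right)
qed

lemma lin_ext_basis [simp]: "lin_ext f (basis x) = f x"
  by (simp add: lin_ext_def basis_def)

section \<open>Tensor products of vectors and maps\<close>

lemma lookup_tens [simp]:
  "Poly_Mapping.lookup (a \<otimes>\<^sub>v b) (x, y) = Poly_Mapping.lookup a x * Poly_Mapping.lookup b y"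
proof -
  have "Poly_Mapping.lookup (a \<otimes>\<^sub>v b) (x, y) =
    (\<Sum>x'\<in>Poly_Mapping.keys a. \<Sum>y'\<in>Poly_Mapping.keys b.
      if x' = x then if y' = y then Poly_Mapping.lookup a x' * Poly_Mapping.lookup b y' else 0 else 0)"
    by (auto simp: tens_def lookup_sum lookup_single when_def intro!: sum.cong)
  also have "\<dots> = (\<Sum>x'\<in>Poly_Mapping.keys a. if x' = x then
      (\<Sum>y'\<in>Poly_Mapping.keys b. if y' = y then Poly_Mapping.lookup a x' * Poly_Mapping.lookup b y' else 0) else 0)"
    by (intro sum.cong) auto
  also have "\<dots> = Poly_Mapping.lookup a x * Poly_Mapping.lookup b y"
    by (auto simp: in_keys_iff)
  finally show ?thesis .
qed

lemma tens_basis [simp]: "basis x \<otimes>\<^sub>v basis y = basis (x, y)"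
  by (rule poly_mapping_eqI) (auto simp: lookup_basis split: if_splits)

lemma tens_add_left: "(a + b) \<otimes>\<^sub>v d = a \<otimes>\<^sub>v d + b \<otimes>\<^sub>v d"
  by (rule poly_mapping_eqI) (auto simp: lookup_add algebra_simps)

lemma tens_add_right: "d \<otimes>\<^sub>v (a + b) = d \<otimes>\<^sub>v a + d \<otimes>\<^sub>v b"
  by (rule poly_mapping_eqI) (auto simp: lookup_add algebra_simps)

lemma tens_scale_left: "scale c a \<otimes>\<^sub>v b = scale c (a \<otimes>\<^sub>v b)"
  by (rule poly_mapping_eqI) (auto simp: algebra_simps)

lemma tens_scale_right: "a \<otimes>\<^sub>v scale c b = scale c (a \<otimes>\<^sub>v b)"
  by (rule poly_mapping_eqI) (auto simp: algebra_simps)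

lemma tens_sum_left: "sum f A \<otimes>\<^sub>v b = (\<Sum>x\<in>A. f x \<otimes>\<^sub>v b)"
  by (rule poly_mapping_eqI) (auto simp: lookup_sum sum_distrib_right)

lemma tens_sum_right: "b \<otimes>\<^sub>v sum f A = (\<Sum>x\<in>A. b \<otimes>\<^sub>v f x)"
  by (rule poly_mapping_eqI) (auto simp: lookup_sum sum_distrib_left)

lemma tens_zero [simp]: "0 \<otimes>\<^sub>v a = 0" "a \<otimes>\<^sub>v 0 = 0"
  by (rule poly_mapping_eqI, auto)+

lemma klinear_tens_left: "klinear (\<lambda>a. a \<otimes>\<^sub>v b)"
  by (simp add: klinear_iff tens_add_left tens_scale_left)

lemma klinear_tens_right: "klinear (\<lambda>a. b \<otimes>\<^sub>v a)"
  by (simp add: klinear_iff tens_add_right tens_scale_right)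

text \<open>Each of these maps is a \<open>lin_ext\<close> by definition; its arguments enter only
  through their values on basis vectors.\<close>

lemma klinear_maps [simp]:
  "klinear (relabel p)" "klinear (f \<otimes>\<^sub>m g)" "klinear assoc_r" "klinear assoc_l" "klinear flip"
  "klinear (contract_l \<phi>)" "klinear (contract_r \<psi>)"
  by (simp_all add: relabel_def tmap_def assoc_r_def assoc_l_def flip_def contract_l_def contract_r_def)

lemma klinear_mid [simp]: "klinear (mid t)"
  by (simp add: mid_def)

lemma maps_basis [simp]:
  "relabel p (basis x) = basis (p x)"
  "(f \<otimes>\<^sub>m g) (basis (y, z)) = f (basis y) \<otimes>\<^sub>v g (basis z)"
  "assoc_r (basis ((u, v), w)) = basis (u, v, w)"
  "assoc_l (basis (u, v, w)) = basis ((u, v), w)"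
  "flip (basis (u, v)) = basis (v, u)"
  "contract_l \<phi> (basis (u, v)) = scale (\<phi> (basis u)) (basis v)"
  "contract_r \<psi> (basis (u, v)) = scale (\<psi> (basis v)) (basis u)"
  by (simp_all add: relabel_def tmap_def assoc_r_def assoc_l_def flip_def contract_l_def contract_r_def)

text \<open>Only the value of \<open>t\<close> at one basis pair matters, so the rule serves a twist
  and its inverse alike, without first proving the inverse linear.\<close>

lemma mid_basis:
  assumes "t (basis (x, y)) = scale c (basis (x', y'))"
  shows "mid t (basis ((w, x), (y, z))) = scale c (basis ((w, x'), (y', z)))"
  by (simp add: mid_def assms tens_scale_left tens_scale_right klinear_maps[THEN klinear_scale])

lemmas linear_simps = klinear_maps[THEN klinear_sum] klinear_maps[THEN klinear_scale]
  klinear_mid[THEN klinear_sum] klinear_mid[THEN klinear_scale] tens_sum_left tens_sum_right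
  tens_scale_left tens_scale_right kvec.scale_sum_right

lemma vector_space_mult: "vector_space ((*) :: 'k::field \<Rightarrow> 'k \<Rightarrow> 'k)"
  by unfold_locales (simp_all add: algebra_simps)

section \<open>Twisted group algebras\<close>

text \<open>The pairs \<open>(x + r, - r)\<close> run through all factorisations of
  \<open>x\<close>, in the same parametrisation as in \<open>group_algebra\<close>, which keeps the
  later comparison of comultiplications termwise.\<close>

definition cocycle_algebra ::
    "('a \<Rightarrow> 'a \<Rightarrow> 'k) \<Rightarrow> ('a::{finite,group_add}, 'k::field) frob" where
  "cocycle_algebra c = \<lparr>
     nabla = lin_ext (\<lambda>(x, y). scale (c x y) (basis (x + y))),
     eta = (\<lambda>k. scale k (basis 0)),
     Delta = lin_ext (\<lambda>x. \<Sum>r\<in>UNIV. scale (inverse (c (x + r) (- r))) (basis (x + r, - r))),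
     eps = (\<lambda>v. Poly_Mapping.lookup v 0) \<rparr>"

text \<open>\<open>cocycle\<close> is associativity on basis vectors, the normalisations make
  \<open>basis 0\<close> a two-sided unit, and \<open>nonzero\<close> gives meaning to the inverse
  coefficients in \<open>Delta\<close>.\<close>

locale normalised_cocycle =
  fixes c :: "'a::{finite,group_add} \<Rightarrow> 'a \<Rightarrow> 'k::field"
  assumes nonzero: "c x y \<noteq> 0"
    and cocycle: "c x y * c (x + y) z = c y z * c x (y + z)"
    and zero_left: "c 0 x = 1"
    and zero_right: "c x 0 = 1"
begin

abbreviation "A \<equiv> cocycle_algebra c"

lemma klinear_structure [simp]: "klinear (nabla A)" "klinear (Delta A)"
  by (simp_all add: cocycle_algebra_def)

lemmas structure_simps = linear_simps
  klinear_structure[THEN klinear_sum] klinear_structure[THEN klinear_scale]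

lemma nabla_basis [simp]: "nabla A (basis (x, y)) = scale (c x y) (basis (x + y))"
  by (simp add: cocycle_algebra_def)

lemma Delta_basis [simp]:
  "Delta A (basis x) = (\<Sum>r\<in>UNIV. scale (inverse (c (x + r) (- r))) (basis (x + r, - r)))"
  by (simp add: cocycle_algebra_def)

lemma eta_eq [simp]: "eta A k = scale k (basis 0)"
  by (simp add: cocycle_algebra_def)

lemma eps_eq [simp]: "eps A v = Poly_Mapping.lookup v 0"
  by (simp add: cocycle_algebra_def)

section \<open>Algebra, coalgebra and Frobenius axioms\<close>

lemma unital: "unital_algebra A"
  unfolding unital_algebra_def
proof (intro conjI allI)
  show "klinear (nabla A)" by simp
  show "Vector_Spaces.linear (*) scale (eta A)"
    by (simp add: Vector_Spaces.linear_iff kvec.vector_space_axioms kvec.scale_left_distrib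
        vector_space_mult)
  show "nabla A \<circ> (nabla A \<otimes>\<^sub>m id) = nabla A \<circ> (id \<otimes>\<^sub>m nabla A) \<circ> assoc_r"
  proof (rule klinear_eqI)
    fix p :: "('a \<times> 'a) \<times> 'a"
    obtain x y z where "p = ((x, y), z)" by (metis prod.exhaust)
    then show "(nabla A \<circ> (nabla A \<otimes>\<^sub>m id)) (basis p) = (nabla A \<circ> (id \<otimes>\<^sub>m nabla A) \<circ> assoc_r) (basis p)"
      using cocycle[of x y z] by (simp add: structure_simps add.assoc)
  qed simp_all
next
  fix k a
  have "nabla A \<circ> (\<lambda>a. basis 0 \<otimes>\<^sub>v a) = id"
    by (rule klinear_eqI) (simp_all add: klinear_tens_right zero_left)
  then show "nabla A (eta A k \<otimes>\<^sub>v a) = scale k a"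
    by (simp add: structure_simps fun_eq_iff)
  have "nabla A \<circ> (\<lambda>a. a \<otimes>\<^sub>v basis 0) = id"
    by (rule klinear_eqI) (simp_all add: klinear_tens_left zero_right)
  then show "nabla A (a \<otimes>\<^sub>v eta A k) = scale k a"
    by (simp add: structure_simps fun_eq_iff)
qed

lemma counital: "counital_coalgebra A"
  unfolding counital_coalgebra_def
proof (intro conjI)
  show "klinear (Delta A)" by simp
  show "Vector_Spaces.linear scale (*) (eps A)"
    by (simp add: Vector_Spaces.linear_iff kvec.vector_space_axioms lookup_add
        vector_space_mult)
  show "assoc_r \<circ> (Delta A \<otimes>\<^sub>m id) \<circ> Delta A = (id \<otimes>\<^sub>m Delta A) \<circ> Delta A"
  proof (rule klinear_eqI)
    fix x
    \<comment> \<open>This is the summand obtained by splitting \<open>x\<close> first and then its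
      right factor \<open>- r\<close>.\<close>
    let ?f = "\<lambda>r s. scale (inverse (c (x + r) (- r)) * inverse (c (- r + s) (- s))) (basis (x + r, - r + s, - s))"
    have "(assoc_r \<circ> (Delta A \<otimes>\<^sub>m id) \<circ> Delta A) (basis x) =
      (\<Sum>r\<in>UNIV. \<Sum>s\<in>UNIV. scale (inverse (c (x + r) (- r)) * inverse (c (x + r + s) (- s)))
         (basis (x + r + s, - s, - r)))"
      by (simp add: structure_simps)
    \<comment> \<open>Matching \<open>(x + r + s, - s, - r)\<close> with the basis triple in
      \<open>?f\<close> forces the arguments \<open>r + s\<close> and \<open>r\<close>. The
      coefficients agree by the cocycle law at the three tensor factors.\<close>
    also have "\<dots> = (\<Sum>r\<in>UNIV. \<Sum>s\<in>UNIV. ?f (r + s) r)"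
    proof (intro sum.cong refl)
      fix r s
      have "c (x + r + s) (- s) * c (x + r) (- r) = c (- s) (- r) * c (x + r + s) (- s - r)"
        using cocycle[of "x + r + s" "- s" "- r"] by simp
      then have "inverse (c (x + r) (- r)) * inverse (c (x + r + s) (- s)) =
          inverse (c (x + (r + s)) (- (r + s))) * inverse (c (- (r + s) + r) (- r))"
        by (simp add: minus_add add.assoc flip: inverse_mult_distrib)
          (simp add: mult.commute)
      then show "scale (inverse (c (x + r) (- r)) * inverse (c (x + r + s) (- s))) (basis (x + r + s, - s, - r)) = ?f (r + s) r"
        by (simp add: minus_add add.assoc)
    qed
    also have "\<dots> = (\<Sum>r\<in>UNIV. \<Sum>s\<in>UNIV. ?f s r)"
    proof (rule sum.cong[OF refl])
      fix r
      show "(\<Sum>s\<in>UNIV. ?f (r + s) r) = (\<Sum>s\<in>UNIV. ?f s r)"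
        by (rule sum.reindex_bij_witness[of _ "\<lambda>s. - r + s" "\<lambda>s. r + s"]) (simp_all flip: add.assoc)
    qed
    also have "\<dots> = (\<Sum>s\<in>UNIV. \<Sum>r\<in>UNIV. ?f s r)"
      by (rule sum.swap)
    also have "\<dots> = ((id \<otimes>\<^sub>m Delta A) \<circ> Delta A) (basis x)"
      by (simp add: structure_simps)
    finally show "(assoc_r \<circ> (Delta A \<otimes>\<^sub>m id) \<circ> Delta A) (basis x) = ((id \<otimes>\<^sub>m Delta A) \<circ> Delta A) (basis x)" .
  qed simp_all
  show "contract_l (eps A) \<circ> Delta A = id"
  proof (rule klinear_eqI)
    fix x
    \<comment> \<open>The counit leaves only \<open>r = - x\<close>, with coefficient
      \<open>inverse (c 0 x) = 1\<close>.\<close>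
    have "(contract_l (eps A) \<circ> Delta A) (basis x) =
      (\<Sum>r\<in>UNIV. if r = - x then basis (- r) else 0)"
      by (auto simp: structure_simps lookup_basis zero_left add_eq_0_iff2 simp del: sum.delta sum.delta' intro!: sum.cong)
    then show "(contract_l (eps A) \<circ> Delta A) (basis x) = id (basis x)"
      by simp
  qed simp_all
  show "contract_r (eps A) \<circ> Delta A = id"
  proof (rule klinear_eqI)
    fix x
    \<comment> \<open>Here only \<open>r = 0\<close> survives, with coefficient
      \<open>inverse (c x 0) = 1\<close>.\<close>
    have "(contract_r (eps A) \<circ> Delta A) (basis x) =
      (\<Sum>r\<in>UNIV. if r = 0 then basis (x + r) else 0)"
      by (auto simp: structure_simps lookup_basis zero_right simp del: sum.delta sum.delta' intro!: sum.cong)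
    then show "(contract_r (eps A) \<circ> Delta A) (basis x) = id (basis x)"
      by simp
  qed simp_all
qed

text \<open>The factorisation of \<open>x + y\<close> with index \<open>r\<close> comes from the
  factorisation of \<open>x\<close> with index \<open>y + r\<close>, by multiplying its right factor
  by \<open>y\<close>. After this shift the coefficients agree by the cocycle law at
  \<open>x + (y + r)\<close>, \<open>- (y + r)\<close>, \<open>y\<close>.\<close>

lemma Delta_nabla_right: "Delta A \<circ> nabla A = (id \<otimes>\<^sub>m nabla A) \<circ> assoc_r \<circ> (Delta A \<otimes>\<^sub>m id)"
proof (rule klinear_eqI)
  fix p :: "'a \<times> 'a"
  obtain x y where p: "p = (x, y)" by (metis prod.exhaust)
  let ?f = "\<lambda>r. scale (inverse (c (x + r) (- r)) * c (- r) y) (basis (x + r, - r + y))"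
  have "(Delta A \<circ> nabla A) (basis p) =
    (\<Sum>r\<in>UNIV. scale (c x y * inverse (c (x + y + r) (- r))) (basis (x + y + r, - r)))"
    by (simp add: p structure_simps)
  also have "\<dots> = (\<Sum>r\<in>UNIV. ?f (y + r))"
  proof (intro sum.cong refl)
    fix r
    have "- (y + r) + y = - r"
      by (simp add: minus_add add.assoc)
    then have "c (x + (y + r)) (- (y + r)) * c x y = c (- (y + r)) y * c (x + (y + r)) (- r)"
      using cocycle[of "x + (y + r)" "- (y + r)" y] by simp
    then have "c x y * inverse (c (x + y + r) (- r)) =
        inverse (c (x + (y + r)) (- (y + r))) * c (- (y + r)) y"
      using nonzero by (simp add: add.assoc field_simps)
    then show "scale (c x y * inverse (c (x + y + r) (- r))) (basis (x + y + r, - r)) = ?f (y + r)"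
      by (simp add: minus_add add.assoc)
  qed
  also have "\<dots> = (\<Sum>r\<in>UNIV. ?f r)"
    by (rule sum.reindex_bij_witness[of _ "\<lambda>s. - y + s" "\<lambda>s. y + s"]) (simp_all flip: add.assoc)
  also have "\<dots> = ((id \<otimes>\<^sub>m nabla A) \<circ> assoc_r \<circ> (Delta A \<otimes>\<^sub>m id)) (basis p)"
    by (simp add: p structure_simps)
  finally show "(Delta A \<circ> nabla A) (basis p) = ((id \<otimes>\<^sub>m nabla A) \<circ> assoc_r \<circ> (Delta A \<otimes>\<^sub>m id)) (basis p)" .
qed simp_all

text \<open>Multiplying the left factor by \<open>x\<close> keeps the index \<open>r\<close>, so the
  sums match termwise by the cocycle law at \<open>x\<close>, \<open>y + r\<close>,
  \<open>- r\<close>.\<close>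

lemma Delta_nabla_left: "Delta A \<circ> nabla A = (nabla A \<otimes>\<^sub>m id) \<circ> assoc_l \<circ> (id \<otimes>\<^sub>m Delta A)"
proof (rule klinear_eqI)
  fix p :: "'a \<times> 'a"
  obtain x y where p: "p = (x, y)" by (metis prod.exhaust)
  have "c x y * inverse (c (x + y + r) (- r)) = inverse (c (y + r) (- r)) * c x (y + r)" for r
    using cocycle[of x "y + r" "- r"] nonzero by (simp add: field_simps add.assoc)
  then show "(Delta A \<circ> nabla A) (basis p) = ((nabla A \<otimes>\<^sub>m id) \<circ> assoc_l \<circ> (id \<otimes>\<^sub>m Delta A)) (basis p)"
    by (simp add: p structure_simps add.assoc)
qed simp_all

theorem frobenius: "frobenius_algebra A"
  unfolding frobenius_algebra_def using unital counital Delta_nabla_right Delta_nabla_left by blast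

section \<open>Symmetry of the pairing and commutativity\<close>

lemma cocycle_minus: "c x (- x) = c (- x) x"
  using cocycle[of x "- x" x] by (simp add: zero_left zero_right)

theorem symmetric: "symmetric A"
  unfolding symmetric_def pairing_def
proof (intro allI)
  fix a b :: "'a \<Rightarrow>\<^sub>0 'k"
  note bilinear = tens_add_left tens_add_right klinear_iff[THEN iffD1, OF klinear_structure(1)] lookup_add
  show "(eps A \<circ> nabla A) (a \<otimes>\<^sub>v b) = (eps A \<circ> nabla A) (b \<otimes>\<^sub>v a)"
  proof (induction a rule: vec_induct)
    case (basis x)
    show ?case
    proof (induction b rule: vec_induct)
      case (basis y)
      \<comment> \<open>Although \<open>x + y\<close> and \<open>y + x\<close> may differ, they
        vanish together, so both pairings are zero except at \<open>y = - x\<close>.\<close>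
      have "x + y = 0 \<longleftrightarrow> y = - x" "y + x = 0 \<longleftrightarrow> y = - x"
        by (auto dest: minus_unique)
      then show ?case
        by (simp add: lookup_basis cocycle_minus)
    qed (simp_all add: bilinear structure_simps)
  qed (simp_all add: bilinear structure_simps)
qed

text \<open>For commuting \<open>x\<close> and \<open>y\<close> both products are multiples of the
  same basis vector. This lets the cocycle detect noncommutativity even when the group is
  abelian.\<close>

lemma commutative_imp_cocycle_eq:
  assumes "commutative A" "x + y = y + x"
  shows "c x y = c y x"
proof -
  have "nabla A (basis x \<otimes>\<^sub>v basis y) = nabla A (basis y \<otimes>\<^sub>v basis x)"
    using assms(1) unfolding commutative_def by blast
  then have "scale (c x y) (basis (y + x)) = scale (c y x) (basis (y + x))"
    by (simp add: assms(2))
  from arg_cong[OF this, of "\<lambda>v. Poly_Mapping.lookup v (y + x)"] show ?thesis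
    by (simp add: lookup_basis)
qed

end

section \<open>Twisted tensor products of group algebras\<close>

text \<open>In the product of \<open>(g, h)\<close> and \<open>(g', h')\<close> the twist moves
  \<open>h\<close> past \<open>g'\<close>, which costs the factor \<open>lam h g'\<close>. Equality
  of whole records transfers all properties at once.\<close>

lemma twisted_tensor_eq_cocycle_algebra:
  fixes \<tau> :: "('h::{finite,group_add} \<times> 'g::{finite,group_add} \<Rightarrow>\<^sub>0 'k::field) \<Rightarrow> ('g \<times> 'h \<Rightarrow>\<^sub>0 'k)"
  assumes "klinear \<tau>" "inj \<tau>" "\<And>h g. lam h g \<noteq> 0"
    and \<tau>: "\<And>h g. \<tau> (basis (h, g)) = scale (lam h g) (basis (g, h))"
  shows "twisted_tensor group_algebra \<tau> group_algebra = cocycle_algebra (\<lambda>x y. lam (snd x) (fst y))"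
proof -
  have inv: "inv \<tau> (basis (g, h)) = scale (inverse (lam h g)) (basis (h, g))" for g h
    by (rule inv_f_eq) (simp_all add: assms klinear_scale[OF assms(1)])
  have "(nabla group_algebra \<otimes>\<^sub>m nabla group_algebra) \<circ> mid \<tau> =
      nabla (cocycle_algebra (\<lambda>x y. lam (snd x) (fst y)))"
    by (rule klinear_eqI)
      (auto simp: cocycle_algebra_def group_algebra_def mid_basis[where t = \<tau>, OF \<tau>] linear_simps)
  moreover have "mid (inv \<tau>) \<circ> (Delta group_algebra \<otimes>\<^sub>m Delta group_algebra) =
      Delta (cocycle_algebra (\<lambda>x y. lam (snd x) (fst y)))"
  proof (rule klinear_eqI)
    fix p :: "'g \<times> 'h"
    obtain g h where "p = (g, h)" by (metis prod.exhaust)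
    then show "(mid (inv \<tau>) \<circ> (Delta group_algebra \<otimes>\<^sub>m Delta group_algebra)) (basis p) =
        Delta (cocycle_algebra (\<lambda>x y. lam (snd x) (fst y))) (basis p)"
      \<comment> \<open>A sum over the product group becomes a double sum; the two sides then differ
        in the order of summation.\<close>
      by (simp add: cocycle_algebra_def group_algebra_def mid_basis[where t = "inv \<tau>", OF inv] linear_simps
          sum.cartesian_product' flip: UNIV_Times_UNIV)
        (rule sum.swap)
  qed (simp_all add: cocycle_algebra_def)
  moreover have "(\<lambda>k. scale k (one_of group_algebra \<otimes>\<^sub>v one_of group_algebra)) =
      eta (cocycle_algebra (\<lambda>x y. lam (snd x) (fst y)))"
    by (simp add: cocycle_algebra_def group_algebra_def linear_simps zero_prod_def)
  moreover have "tfunctional (eps group_algebra) (eps group_algebra) =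
      eps (cocycle_algebra (\<lambda>x y. lam (snd x) (fst y)))"
  proof
    fix v :: "'g \<times> 'h \<Rightarrow>\<^sub>0 'k"
    \<comment> \<open>Only the identity pair contributes; if it is not a key, its coefficient is 0
      anyway.\<close>
    have "tfunctional (eps group_algebra) (eps group_algebra) v =
      (\<Sum>p\<in>Poly_Mapping.keys v. if p = 0 then Poly_Mapping.lookup v p else 0)"
      unfolding tfunctional_def
      by (rule sum.cong) (auto simp: group_algebra_def lookup_basis zero_prod_def split: if_splits)
    then show "tfunctional (eps group_algebra) (eps group_algebra) v =
      eps (cocycle_algebra (\<lambda>x y. lam (snd x) (fst y))) v"
      by (simp add: cocycle_algebra_def in_keys_iff)
  qed
  ultimately show ?thesis
    unfolding twisted_tensor_def by simp
qed

theorem corollary1p4: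
  fixes \<tau> :: "('h::{finite,group_add} \<times> 'g::{finite,group_add} \<Rightarrow>\<^sub>0 'k::field) \<Rightarrow> ('g \<times> 'h \<Rightarrow>\<^sub>0 'k)"
    and lam :: "'h \<Rightarrow> 'g \<Rightarrow> 'k"
  assumes "twisting_map group_algebra group_algebra \<tau>"
    and "strongly_graded \<tau>"
    and "\<tau> \<noteq> flip"
    and "\<And>h g. lam h g \<noteq> 0"
    and "\<And>h g. \<tau> (basis h \<otimes>\<^sub>v basis g) = scale (lam h g) (basis g \<otimes>\<^sub>v basis h)"
    and "\<And>g h s. lam h g = lam (- s) g * lam (s + h) g"
    and "\<And>g r h. lam h g = lam h (- r) * lam h (r + g)"
  shows "frobenius_algebra (twisted_tensor group_algebra \<tau> group_algebra) \<and>
         symmetric (twisted_tensor group_algebra \<tau> group_algebra) \<and>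
         \<not> commutative (twisted_tensor group_algebra \<tau> group_algebra)"
proof -
  let ?c = "\<lambda>x y. lam (snd x) (fst y) :: 'k"
  have lin: "klinear \<tau>" and inj: "inj \<tau>"
    using assms(1) unfolding twisting_map_def bij_def by blast+
  have \<tau>: "\<tau> (basis (h, g)) = scale (lam h g) (basis (g, h))" for h g
    using assms(5)[of h g] by simp
  \<comment> \<open>Substituting the inverse of \<open>a\<close> for the free group element turns
    each of the two hypotheses into multiplicativity in one argument.\<close>
  have add_left: "lam (a + b) g = lam a g * lam b g" for a b g
    using assms(6)[of "a + b" g "- a"] by simp
  have add_right: "lam h (a + b) = lam h a * lam h b" for a b h
    using assms(7)[of h "a + b" "- a"] by simp
  \<comment> \<open>A nonzero scalar equal to its own square is 1.\<close>
  have zero: "lam 0 g = 1" "lam h 0 = 1" for g h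
    using add_left[of 0 0 g] add_right[of h 0 0] assms(4)[of 0 g] assms(4)[of h 0] by simp_all
  \<comment> \<open>By bimultiplicativity both sides of the cocycle law at \<open>x\<close>,
    \<open>y\<close>, \<open>z\<close> expand to the product of \<open>?c x y\<close>,
    \<open>?c x z\<close> and \<open>?c y z\<close>.\<close>
  interpret normalised_cocycle ?c
    by unfold_locales (simp_all add: assms(4) add_left add_right zero mult_ac)
  obtain h g where hg: "lam h g \<noteq> 1"
  proof (rule ccontr)
    assume "\<not> thesis"
    then have "lam h g = 1" for h g
      using that by blast
    then have "\<tau> = flip"
      by (intro klinear_eqI) (auto simp: lin \<tau>)
    then show False
      using assms(3) by blast
  qed
  have "\<not> commutative (cocycle_algebra ?c)"
    \<comment> \<open>These two elements always commute in the product group; one order gives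
      \<open>lam h g\<close>, the other \<open>lam 0 0 = 1\<close>.\<close>
    using commutative_imp_cocycle_eq[of "(0, h)" "(g, 0)"] hg by (auto simp: zero)
  then show ?thesis
    using frobenius symmetric twisted_tensor_eq_cocycle_algebra[OF lin inj assms(4) \<tau>] by simp
qed

end
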